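(* Let $E$ be a Riesz space with a Fatou $M$-norm $\|\cdot\|$ such that the supremum \[ f^{\ast}:=\sup\{g\in E:0\le g\le f\text{ and }\|g\|\le 1\} \] exists in $E$ for every $f\in E^{+}$. Let $\eta E$ be the spectrum of $E$ with respect to the truncation $f\mapsto f^{\ast}$. Then $E$ is isomorphic, as a normed Riesz space (that is, via an isometric Riesz isomorphism), to a uniformly dense truncated Riesz subspace of $C_{0}(\eta E)$.
   Context: A Riesz space is a real vector lattice, with positive cone $E^{+}$. A norm $\|\cdot\|$ on a Riesz space $E$ is a Riesz norm if $|f|\le|g|$ implies $\|f\|\le\|g\|$. A Riesz norm is a Fatou norm if for every increasing net $(f_{a})_{a\in A}$ in $E^{+}$ with supremum $f\in E$ one has $\|f\|=\sup\{\|f_{a}\|:a\in A\}$. A Riesz norm is an $M$-norm if $\|f\vee g\|=\max\{\|f\|,\|g\|\}$ for all $f,g\in E^{+}$. A Fatou $M$-norm is a Riesz norm that is both a Fatou norm and an $M$-norm. A truncation on a Riesz space $E$ is a unary operation $\ast:E^{+}\to E^{+}$, $f\mapsto f^{\ast}$, such that $f^{\ast}\wedge g=f\wedge g^{\ast}$ for all $f,g\in E^{+}$; the operation $f\mapsto f^{\ast}$ in the claim is a truncation. The spectrum $\eta E$ of a Riesz space $E$ with a truncation is the set of all nonzero Riesz homomorphisms (linear lattice homomorphisms) $u:E\to\mathbb{R}$ such that $u(f^{\ast})=\min\{1,u(f)\}$ for all $f\in E^{+}$, with the topology inherited from the product topology on $\mathbb{R}^{E}$; here it is a locally compact Hausdorff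 space. For a locally compact Hausdorff space $X$, $C_{0}(X)$ is the Riesz space of continuous $f:X\to\mathbb{R}$ such that $\{x\in X:|f(x)|\ge\varepsilon\}$ is compact for every $\varepsilon>0$, with the uniform norm. A truncated Riesz subspace of $C_{0}(X)$ is a Riesz subspace $F$ such that $1\wedge f\in F$ for all $f\in F$. "Uniformly dense" means dense for the uniform norm. *)

theory Defs
  imports
    "HOL-Analysis.Analysis"
    "HOL-Library.Lattice_Algebras"
    "HOL-Library.Lub_Glb"
begin

section \<open>Riesz spaces and norms on them\<close>

class riesz_space = ordered_real_vector + lattice_ab_group_add_abs

definition riesz_norm :: "('e::{riesz_space, real_normed_vector} \<Rightarrow> real) \<Rightarrow> bool" where
  "riesz_norm N \<longleftrightarrow> (\<forall>f g. \<bar>f\<bar> \<le> \<bar>g\<bar> \<longrightarrow> N f \<le> N g)"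

definition directed_index :: "'i set \<Rightarrow> ('i \<Rightarrow> 'i \<Rightarrow> bool) \<Rightarrow> bool" where
  "directed_index A r \<longleftrightarrow>
     A \<noteq> {} \<and> (\<forall>a\<in>A. r a a) \<and>
     (\<forall>a\<in>A. \<forall>b\<in>A. \<forall>c\<in>A. r a b \<longrightarrow> r b c \<longrightarrow> r a c) \<and>
     (\<forall>a\<in>A. \<forall>b\<in>A. \<exists>c\<in>A. r a c \<and> r b c)"

definition increasing_net :: "'i set \<Rightarrow> ('i \<Rightarrow> 'i \<Rightarrow> bool) \<Rightarrow> ('i \<Rightarrow> 'e::order) \<Rightarrow> bool" where
  "increasing_net A r F \<longleftrightarrow>
     directed_index A r \<and> (\<forall>a\<in>A. \<forall>b\<in>A. r a b \<longrightarrow> F a \<le> F b)"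

text \<open>A definition cannot quantify over all index types.  Index sets inside \<open>'e\<close> suffice, because
  an increasing net can be re-indexed by its range; see \<open>fatou_norm_net\<close> below.\<close>

definition fatou_norm :: "('e::{riesz_space, real_normed_vector} \<Rightarrow> real) \<Rightarrow> bool" where
  "fatou_norm N \<longleftrightarrow> riesz_norm N \<and>
     (\<forall>(A::'e set) r F f.
        increasing_net A r F \<longrightarrow> (\<forall>a\<in>A. 0 \<le> F a) \<longrightarrow> isLub UNIV (F ` A) f \<longrightarrow>
        N f = (SUP a\<in>A. N (F a)))"

definition M_norm :: "('e::{riesz_space, real_normed_vector} \<Rightarrow> real) \<Rightarrow> bool" where
  "M_norm N \<longleftrightarrow> riesz_norm N \<and>
     (\<forall>f g. 0 \<le> f \<longrightarrow> 0 \<le> g \<longrightarrow> N (sup f g) = max (N f) (N g))"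

lemma fatou_norm_net:
  fixes N :: "'e::{riesz_space, real_normed_vector} \<Rightarrow> real" and F :: "'i \<Rightarrow> 'e"
  assumes N: "fatou_norm N" and net: "increasing_net A r F"
    and pos: "\<And>a. a \<in> A \<Longrightarrow> 0 \<le> F a" and lub: "isLub UNIV (F ` A) f"
  shows "N f = (SUP a\<in>A. N (F a))"
proof -
  have dir: "\<exists>z\<in>F ` A. x \<le> z \<and> y \<le> z" if xy: "x \<in> F ` A" "y \<in> F ` A" for x y
  proof -
    obtain a b where ab: "a \<in> A" "b \<in> A" "x = F a" "y = F b"
      using xy by blast
    then obtain c where "c \<in> A" "r a c" "r b c"
      using net unfolding increasing_net_def directed_index_def by meson
    then show ?thesis
      using ab net unfolding increasing_net_def by blast
  qed
  have "A \<noteq> {}"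
    using net unfolding increasing_net_def directed_index_def by blast
  then have "increasing_net (F ` A) (\<le>) (\<lambda>x. x)"
    unfolding increasing_net_def directed_index_def
    by (intro conjI ballI impI dir; (erule (1) order_trans | assumption | simp))
  moreover have "isLub UNIV ((\<lambda>x. x) ` F ` A) f"
    using lub by simp
  ultimately have "N f = (SUP x\<in>F ` A. N x)"
    using N pos unfolding fatou_norm_def by blast
  then show ?thesis
    by (simp add: image_image)
qed

section \<open>Truncations and the spectrum\<close>

text \<open>A truncation acts on the positive cone only; it is modelled by a total function whose values
  off the cone are irrelevant.\<close>

definition truncation :: "('e::riesz_space \<Rightarrow> 'e) \<Rightarrow> bool" where
  "truncation tr \<longleftrightarrow>
     (\<forall>f. 0 \<le> f \<longrightarrow> 0 \<le> tr f) \<and>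
     (\<forall>f g. 0 \<le> f \<longrightarrow> 0 \<le> g \<longrightarrow> inf (tr f) g = inf f (tr g))"

definition real_riesz_hom :: "('e::riesz_space \<Rightarrow> real) \<Rightarrow> bool" where
  "real_riesz_hom u \<longleftrightarrow> linear u \<and>
     (\<forall>f g. u (sup f g) = max (u f) (u g) \<and> u (inf f g) = min (u f) (u g))"

definition spectrum :: "('e::riesz_space \<Rightarrow> 'e) \<Rightarrow> ('e \<Rightarrow> real) set" where
  "spectrum tr =
     {u. real_riesz_hom u \<and> u \<noteq> (\<lambda>f. 0) \<and> (\<forall>f. 0 \<le> f \<longrightarrow> u (tr f) = min 1 (u f))}"

definition spectrum_topology :: "('e::riesz_space \<Rightarrow> 'e) \<Rightarrow> ('e \<Rightarrow> real) topology" where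
  "spectrum_topology tr =
     subtopology (product_topology (\<lambda>f. euclideanreal) UNIV) (spectrum tr)"

section \<open>The Riesz space of continuous functions vanishing at infinity\<close>

text \<open>A function on \<open>X\<close> is represented by its extension by \<open>0\<close> outside \<open>topspace X\<close>.
  The Riesz space operations are pointwise.\<close>

definition C0 :: "'x topology \<Rightarrow> ('x \<Rightarrow> real) set" where
  "C0 X = {h. continuous_map X euclideanreal h \<and> (\<forall>x. x \<notin> topspace X \<longrightarrow> h x = 0) \<and>
              (\<forall>\<epsilon>>0. compactin X {x \<in> topspace X. \<bar>h x\<bar> \<ge> \<epsilon>})}"

text \<open>The \<open>0\<close> is inserted so that the norm is \<open>0\<close> when \<open>X\<close> is empty.\<close>

definition uniform_norm :: "'x topology \<Rightarrow> ('x \<Rightarrow> real) \<Rightarrow> real" where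
  "uniform_norm X h = Sup (insert 0 ((\<lambda>x. \<bar>h x\<bar>) ` topspace X))"

definition riesz_subspace_C0 :: "'x topology \<Rightarrow> ('x \<Rightarrow> real) set \<Rightarrow> bool" where
  "riesz_subspace_C0 X F \<longleftrightarrow>
     F \<subseteq> C0 X \<and> (\<lambda>x. 0) \<in> F \<and>
     (\<forall>h\<in>F. \<forall>k\<in>F. (\<lambda>x. h x + k x) \<in> F) \<and>
     (\<forall>c. \<forall>h\<in>F. (\<lambda>x. c * h x) \<in> F) \<and>
     (\<forall>h\<in>F. \<forall>k\<in>F. (\<lambda>x. max (h x) (k x)) \<in> F \<and> (\<lambda>x. min (h x) (k x)) \<in> F)"

definition truncated_riesz_subspace_C0 :: "'x topology \<Rightarrow> ('x \<Rightarrow> real) set \<Rightarrow> bool" where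
  "truncated_riesz_subspace_C0 X F \<longleftrightarrow>
     riesz_subspace_C0 X F \<and> (\<forall>h\<in>F. (\<lambda>x. min 1 (h x)) \<in> F)"

definition uniformly_dense_C0 :: "'x topology \<Rightarrow> ('x \<Rightarrow> real) set \<Rightarrow> bool" where
  "uniformly_dense_C0 X F \<longleftrightarrow>
     (\<forall>h\<in>C0 X. \<forall>\<epsilon>>0. \<exists>k\<in>F. uniform_norm X (\<lambda>x. h x - k x) < \<epsilon>)"

definition isometric_riesz_iso ::
    "'x topology \<Rightarrow> ('x \<Rightarrow> real) set \<Rightarrow> ('e::{riesz_space, real_normed_vector} \<Rightarrow> 'x \<Rightarrow> real) \<Rightarrow> bool"
  where
  "isometric_riesz_iso X F \<Phi> \<longleftrightarrow>
     bij_betw \<Phi> UNIV F \<and>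
     (\<forall>f g. \<Phi> (f + g) = (\<lambda>x. \<Phi> f x + \<Phi> g x)) \<and>
     (\<forall>c f. \<Phi> (c *\<^sub>R f) = (\<lambda>x. c * \<Phi> f x)) \<and>
     (\<forall>f g. \<Phi> (sup f g) = (\<lambda>x. max (\<Phi> f x) (\<Phi> g x))) \<and>
     (\<forall>f g. \<Phi> (inf f g) = (\<lambda>x. min (\<Phi> f x) (\<Phi> g x))) \<and>
     (\<forall>f. uniform_norm X (\<Phi> f) = norm f)"

section \<open>The truncation by the unit ball, and its spectrum\<close>

lemma isLub_UNIV_iff:
  "isLub UNIV S x \<longleftrightarrow> (\<forall>s\<in>S. s \<le> x) \<and> (\<forall>y. (\<forall>s\<in>S. s \<le> y) \<longrightarrow> x \<le> y)"
  by (auto simp: isLub_def isUb_def leastP_def setle_def setge_def)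

lemma inf_add_diff_sup:
  fixes a b :: "'e::riesz_space"
  shows "inf a b = a + b - sup a b"
  by (metis add_diff_cancel_left' add_eq_inf_sup)

lemma unit_ball_truncation:
  fixes tr :: "'e::{riesz_space, real_normed_vector} \<Rightarrow> 'e"
  assumes N: "riesz_norm (norm :: 'e \<Rightarrow> real)"
    and tr: "\<And>f. 0 \<le> f \<Longrightarrow> isLub UNIV {g. 0 \<le> g \<and> g \<le> f \<and> norm g \<le> 1} (tr f)"
  shows "truncation tr"
proof -
  have ge: "h \<le> tr f" if "0 \<le> f" "0 \<le> h" "h \<le> f" "norm h \<le> 1" for f h
    using tr[OF that(1)] that unfolding isLub_UNIV_iff by blast
  have le: "tr f \<le> y" if "0 \<le> f" "\<And>h. 0 \<le> h \<Longrightarrow> h \<le> f \<Longrightarrow> norm h \<le> 1 \<Longrightarrow> h \<le> y" for f y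
    using tr[OF that(1)] that unfolding isLub_UNIV_iff by blast
  have half: "inf (tr f) g \<le> inf f (tr g)" if f: "0 \<le> f" and g: "0 \<le> g" for f g
  proof -
    have "tr f \<le> tr g + sup (tr f) g - g"
    proof (rule le[OF f])
      fix h assume h: "0 \<le> h" "h \<le> f" "norm h \<le> 1"
      have "\<bar>inf h g\<bar> \<le> \<bar>h\<bar>"
        using h g by (simp add: abs_of_nonneg)
      then have "norm (inf h g) \<le> 1"
        using N h(3) unfolding riesz_norm_def by (meson order_trans)
      then have "inf h g \<le> tr g"
        using h g by (intro ge) auto
      then have "h + g - sup h g \<le> tr g"
        by (simp only: inf_add_diff_sup)
      moreover have "sup h g \<le> sup (tr f) g"
        using ge[OF f h] by (simp add: le_supI1)
      ultimately have "(h + g - sup h g) + sup h g \<le> tr g + sup (tr f) g"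
        by (rule add_mono)
      then show "h \<le> tr g + sup (tr f) g - g"
        by (simp only: le_diff_eq diff_add_cancel)
    qed
    then have "inf (tr f) g \<le> tr g"
      by (simp only: inf_add_diff_sup le_diff_eq diff_le_eq)
    moreover have "tr f \<le> f"
      by (rule le[OF f])
    ultimately show ?thesis
      by (simp add: le_infI1)
  qed
  have "0 \<le> tr f" if "0 \<le> f" for f
    using ge[OF that, of 0] that by simp
  moreover have "inf (tr f) g = inf f (tr g)" if "0 \<le> f" "0 \<le> g" for f g
    using half[OF that] half[OF that(2,1)] by (simp add: inf.commute order_antisym)
  ultimately show ?thesis
    unfolding truncation_def by blast
qed

lemma abs_spectrum_le_norm:
  fixes tr :: "'e::{riesz_space, real_normed_vector} \<Rightarrow> 'e"
  assumes N: "riesz_norm (norm :: 'e \<Rightarrow> real)"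
    and tr: "\<And>f. 0 \<le> f \<Longrightarrow> isLub UNIV {g. 0 \<le> g \<and> g \<le> f \<and> norm g \<le> 1} (tr f)"
    and hom: "real_riesz_hom u" and u: "\<And>f. 0 \<le> f \<Longrightarrow> u (tr f) = min 1 (u f)"
  shows "\<bar>u f\<bar> \<le> norm f"
proof -
  have lin: "linear u" using hom by (simp add: real_riesz_hom_def)
  define g where "g = \<bar>f\<bar>"
  have g: "0 \<le> g" by (simp add: g_def)
  have ng: "norm g \<le> norm f"
    using N unfolding riesz_norm_def g_def by simp
  have "u g = max (u f) (u (- f))"
    using hom unfolding g_def real_riesz_hom_def abs_lattice by blast
  then have ug: "u g = \<bar>u f\<bar>"
    using linear_neg[OF lin] by (auto simp: max_def)
  show ?thesis
  proof (cases "g = 0")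
    case True
    then show ?thesis using ug linear_0[OF lin] by simp
  next
    case False
    define h where "h = (1 / norm g) *\<^sub>R g"
    have h: "0 \<le> h" "norm h \<le> 1"
      using g False by (auto simp: h_def intro: scaleR_nonneg_nonneg)
    have "tr h = h"
      using tr[OF h(1)] h unfolding isLub_UNIV_iff by (intro order_antisym) auto
    then have "u h \<le> 1"
      using u[OF h(1)] by simp
    then have "u g / norm g \<le> 1"
      using linear_scale[OF lin] by (simp add: h_def)
    then have "u g \<le> norm g"
      using False by (simp add: divide_le_eq)
    then show ?thesis using ug ng by simp
  qed
qed

lemma spectrum_Hausdorff: "Hausdorff_space (spectrum_topology tr)"
  unfolding spectrum_topology_def
  by (intro Hausdorff_space_subtopology) (simp add: Hausdorff_space_product_topology)

lemma spectrum_locally_compact: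
  fixes tr :: "'e::{riesz_space, real_normed_vector} \<Rightarrow> 'e"
  assumes N: "riesz_norm (norm :: 'e \<Rightarrow> real)"
    and tr: "\<And>f. 0 \<le> f \<Longrightarrow> isLub UNIV {g. 0 \<le> g \<and> g \<le> f \<and> norm g \<le> 1} (tr f)"
  shows "locally_compact_space (spectrum_topology tr)"
proof -
  define T :: "('e \<Rightarrow> real) topology" where "T = product_topology (\<lambda>f. euclideanreal) UNIV"
  have T: "T = euclidean" by (simp add: T_def euclidean_product_topology)
  define B :: "('e \<Rightarrow> real) set" where "B = PiE UNIV (\<lambda>f. {- norm f..norm f})"
  define C :: "('e \<Rightarrow> real) set" where
    "C = {u. real_riesz_hom u \<and> (\<forall>f. 0 \<le> f \<longrightarrow> u (tr f) = min 1 (u f))}"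
  have C_eq: "C = {u. (\<forall>f g. u (f + g) = u f + u g) \<and> (\<forall>c f. u (c *\<^sub>R f) = c * u f) \<and>
      (\<forall>f g. u (sup f g) = max (u f) (u g) \<and> u (inf f g) = min (u f) (u g)) \<and>
      (\<forall>f\<in>{f. 0 \<le> f}. u (tr f) = min 1 (u f))}"
    unfolding C_def real_riesz_hom_def linear_iff by auto
  have coord: "continuous_on UNIV (\<lambda>u :: 'e \<Rightarrow> real. u f)" for f
    by (rule continuous_on_product_coordinates)
  have "closed C"
    unfolding C_eq Ball_def
    by (intro closed_Collect_conj closed_Collect_all closed_Collect_imp closed_Collect_eq
        open_Collect_const continuous_on_add continuous_on_mult continuous_on_max
        continuous_on_min continuous_on_const coord)
  moreover have "compact B"
  proof -
    have "compactin T B"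
      unfolding T_def B_def by (simp add: compactin_PiE)
    then show ?thesis by (simp add: T)
  qed
  ultimately have "compact (C \<inter> B)"
    by (rule closed_Int_compact)
  moreover have "C \<subseteq> B"
  proof
    fix u assume "u \<in> C"
    then have "\<bar>u f\<bar> \<le> norm f" for f
      using abs_spectrum_le_norm[OF N tr, of u f] by (simp add: C_def)
    then show "u \<in> B"
      unfolding B_def by (simp add: PiE_iff abs_le_iff minus_le_iff)
  qed
  then have "C \<inter> B = C" by blast
  ultimately have "compactin T C" by (simp add: T)
  then have lc: "locally_compact_space (subtopology T C)"
    by (simp add: compact_imp_locally_compact_space compact_space_subtopology)
  have H: "Hausdorff_space T" by (simp add: T_def Hausdorff_space_product_topology)
  have sub: "spectrum tr = C \<inter> - {\<lambda>f. 0}"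
    by (auto simp: spectrum_def C_def)
  have "closedin T {\<lambda>f. 0}"
    unfolding closedin_Hausdorff_sing_eq[OF H] by (simp add: T)
  then have "openin T (- {\<lambda>f. 0})"
    by (simp add: T open_closed)
  then have op: "openin (subtopology T C) (spectrum tr)"
    unfolding sub by (rule openin_subtopology_Int2)
  have "locally_compact_space (subtopology (subtopology T C) (spectrum tr))"
    using locally_compact_space_open_subset[OF _ lc op] Hausdorff_space_subtopology[OF H] by blast
  moreover have "C \<inter> spectrum tr = spectrum tr" using sub by blast
  ultimately show ?thesis
    by (simp add: spectrum_topology_def T_def subtopology_subtopology)
qed

end

theory Submission
  imports Defs
begin

text \<open>
  The isomorphism is evaluation: \<open>f\<close> goes to the function \<open>u \<mapsto> u f\<close> on the spectrum.  That it
  respects the Riesz space operations is built into the definition of the spectrum.  Two things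
  have to be proved: there are enough points for evaluation to be isometric, and the image is dense.

  \<^emph>\<open>Enough points.\<close>  For an \<open>M\<close>-norm, \<open>p x = \<parallel>x\<^sup>+\<parallel>\<close> is a sublinear functional
  that turns suprema into maxima.  Such functionals behave like \<open>x \<mapsto> max {u x | u \<in> K}\<close> for a
  compact set \<open>K\<close> of Riesz homomorphisms, so the minimal ones should correspond to single points.
  This is what happens (\<open>minimal_max_sublinear_linear\<close>): as in the proof of the Hahn-Banach
  theorem, a functional that is not linear can be strictly decreased, and the decreasing limit used
  for this keeps the maximum property.  Zorn's lemma, started below \<open>p\<close> at a functional concentrated
  where a given \<open>f \<ge> 0\<close> is largest, yields a Riesz homomorphism \<open>u \<le> p\<close> with \<open>u f = \<parallel>f\<parallel>\<close>
  (\<open>M_norm_attained_by_hom\<close>).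

  The unit ball below \<open>f\<close> is directed upwards because the norm is an \<open>M\<close>-norm, so the Fatou property
  gives \<open>\<parallel>f\<^sup>*\<parallel> \<le> 1\<close>.  Hence \<open>u (g\<^sup>*) \<le> 1\<close> for all \<open>g \<ge> 0\<close>.  Comparing \<open>g\<close> with a
  vector \<open>e\<close> such that \<open>\<parallel>e\<parallel> = 1 = u e\<close> through the truncation identity
  \<open>g\<^sup>* \<and> e = g \<and> e\<^sup>* = g \<and> e\<close> then forces \<open>u (g\<^sup>*) = min 1 (u g)\<close>, so \<open>u\<close> lies in the spectrum.

  \<^emph>\<open>Density.\<close>  Adjoining the zero functional to the spectrum gives a set that is closed
  in a product of compact intervals, hence compact: the zero functional is the point at infinity.
  Elements of \<open>C\<^sub>0\<close> are the continuous functions on this compact set that vanish at the zero functional.  Different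
  points of the spectrum are linearly independent, because a positive multiple of a point
  is compatible with the truncation only if the factor is \<open>1\<close>.  So the image interpolates arbitrary
  values at two points, and the lattice form of the Stone-Weierstrass theorem applies.
\<close>

section \<open>Sublinear functionals that preserve finite suprema\<close>

definition max_sublinear :: "('e::riesz_space \<Rightarrow> real) \<Rightarrow> bool" where
  "max_sublinear q \<longleftrightarrow>
     (\<forall>x y. q (x + y) \<le> q x + q y) \<and>
     (\<forall>c x. 0 < c \<longrightarrow> q (c *\<^sub>R x) \<le> c * q x) \<and>
     (\<forall>x y. q (sup x y) = max (q x) (q y))"

lemma max_sublinearD:
  assumes "max_sublinear q"
  shows "q (x + y) \<le> q x + q y" and "0 < c \<Longrightarrow> q (c *\<^sub>R x) \<le> c * q x"
    and "q (sup x y) = max (q x) (q y)"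
  using assms unfolding max_sublinear_def by blast+

lemma max_sublinear_scale:
  assumes q: "max_sublinear q" and c: "0 \<le> c"
  shows "q (c *\<^sub>R x) = c * q x"
proof -
  have pos: "q (d *\<^sub>R y) = d * q y" if d: "0 < d" for d y
  proof (rule antisym)
    show "q (d *\<^sub>R y) \<le> d * q y"
      using max_sublinearD(2)[OF q d] .
    have "q (inverse d *\<^sub>R (d *\<^sub>R y)) \<le> inverse d * q (d *\<^sub>R y)"
      using d by (intro max_sublinearD(2)[OF q]) simp
    then have "q y \<le> q (d *\<^sub>R y) / d"
      using d by (simp add: divide_inverse mult.commute)
    then show "d * q y \<le> q (d *\<^sub>R y)"
      using d by (simp add: pos_le_divide_eq mult.commute)
  qed
  have "q 0 = 0"
    using pos[of 2 0] by simp
  then show ?thesis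
    using pos[of c x] c by (cases "c = 0") auto
qed

lemma max_sublinear_0: "max_sublinear q \<Longrightarrow> q 0 = 0"
  using max_sublinear_scale[of q 0 0] by simp

lemma max_sublinear_lower:
  assumes q: "max_sublinear q"
  shows "- q (- x) \<le> q x"
  using max_sublinearD(1)[OF q, of x "- x"] max_sublinear_0[OF q] by simp

text \<open>An infimum of maximum preserving functions need not preserve maxima; it does if the family is
  directed downwards, since then both values at \<open>x\<close> and \<open>y\<close> are approximated by one member.
  Sublinearity is asked of the family as a whole because the members used below, \<open>x \<mapsto> q (x + t h) - t q h\<close>
  for \<open>t \<ge> 0\<close>, are not homogeneous.\<close>

lemma max_sublinear_INF:
  fixes Q :: "('e::riesz_space \<Rightarrow> real) set"
  assumes ne: "Q \<noteq> {}"
    and bdd: "\<And>x. bdd_below ((\<lambda>q. q x) ` Q)"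
    and dir: "\<And>p q. p \<in> Q \<Longrightarrow> q \<in> Q \<Longrightarrow> \<exists>r\<in>Q. \<forall>x. r x \<le> p x \<and> r x \<le> q x"
    and mx: "\<And>q x y. q \<in> Q \<Longrightarrow> q (sup x y) = max (q x) (q y)"
    and sub: "\<And>p q x y. p \<in> Q \<Longrightarrow> q \<in> Q \<Longrightarrow> \<exists>r\<in>Q. r (x + y) \<le> p x + q y"
    and hom: "\<And>q c x. q \<in> Q \<Longrightarrow> 0 < c \<Longrightarrow> \<exists>r\<in>Q. r (c *\<^sub>R x) \<le> c * q x"
  shows "max_sublinear (\<lambda>x. INF q\<in>Q. q x)"
proof -
  define m where "m x = (INF q\<in>Q. q x)" for x
  have lower: "m x \<le> q x" if "q \<in> Q" for q x
    unfolding m_def by (rule cINF_lower[OF bdd that])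
  have greatest: "a \<le> m x" if "\<And>q. q \<in> Q \<Longrightarrow> a \<le> q x" for a x
    unfolding m_def by (rule cINF_greatest[OF ne that])
  have approx: "\<exists>q\<in>Q. q x < a" if "m x < a" for x a
    using that greatest[of a x] by (meson not_le)
  have "m (x + y) \<le> m x + m y" for x y
  proof (rule field_le_epsilon)
    fix e :: real assume "0 < e"
    then obtain p q where pq: "p \<in> Q" "q \<in> Q" "p x < m x + e/2" "q y < m y + e/2"
      using approx[of x "m x + e/2"] approx[of y "m y + e/2"] by auto
    then obtain r where "r \<in> Q" "r (x + y) \<le> p x + q y"
      using sub by blast
    then show "m (x + y) \<le> m x + m y + e"
      using lower[of r "x + y"] pq by linarith
  qed
  moreover have "m (c *\<^sub>R x) \<le> c * m x" if c: "0 < c" for c x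
  proof -
    have "m (c *\<^sub>R x) / c \<le> m x"
    proof (rule greatest)
      fix q assume "q \<in> Q"
      then obtain r where "r \<in> Q" "r (c *\<^sub>R x) \<le> c * q x"
        using hom c by blast
      then show "m (c *\<^sub>R x) / c \<le> q x"
        using lower[of r "c *\<^sub>R x"] c by (simp add: divide_le_eq mult.commute)
    qed
    then show ?thesis
      using c by (simp add: divide_le_eq mult.commute)
  qed
  moreover have "m (sup x y) = max (m x) (m y)" for x y
  proof (rule antisym)
    have "m x \<le> m (sup x y)" "m y \<le> m (sup x y)"
      by (auto intro!: greatest simp: mx le_max_iff_disj lower)
    then show "max (m x) (m y) \<le> m (sup x y)"
      by simp
    show "m (sup x y) \<le> max (m x) (m y)"
    proof (rule field_le_epsilon)
      fix e :: real assume "0 < e"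
      then obtain p q where pq: "p \<in> Q" "q \<in> Q" "p x < m x + e" "q y < m y + e"
        using approx[of x "m x + e"] approx[of y "m y + e"] by auto
      then obtain r where r: "r \<in> Q" "r x \<le> p x" "r y \<le> q y"
        using dir by blast
      then have "max (r x) (r y) \<le> max (m x) (m y) + e"
        using pq by (auto simp: max_def)
      then show "m (sup x y) \<le> max (m x) (m y) + e"
        using lower[OF r(1), of "sup x y"] mx[OF r(1), of x y] by linarith
    qed
  qed
  ultimately show ?thesis
    unfolding max_sublinear_def m_def by blast
qed

text \<open>The one-sided derivative of \<open>q\<close> at \<open>h\<close> in direction \<open>x\<close>, as a limit of difference quotients
  with step \<open>1 / t\<close>.  If \<open>q\<close> is the maximum over a
  compact set of functionals, this is the maximum over the face on which \<open>h\<close> attains \<open>q h\<close>.\<close>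

definition concentrate :: "('e::riesz_space \<Rightarrow> real) \<Rightarrow> 'e \<Rightarrow> 'e \<Rightarrow> real" where
  "concentrate q h x = (INF t\<in>{0..}. q (x + t *\<^sub>R h) - t * q h)"

lemma
  fixes q :: "'e::riesz_space \<Rightarrow> real"
  assumes q: "max_sublinear q"
  shows max_sublinear_concentrate: "max_sublinear (concentrate q h)"
    and concentrate_le: "concentrate q h x \<le> q x"
    and concentrate_uminus: "concentrate q h (- h) \<le> - q h"
proof -
  define s where "s t x = q (x + t *\<^sub>R h) - t * q h" for t x
  have low: "- q (- x) \<le> s t x" if "0 \<le> t" for t x
    using max_sublinearD(1)[OF q, of "x + t *\<^sub>R h" "- x"] max_sublinear_scale[OF q that]
    by (simp add: s_def)
  have bdd: "bdd_below ((\<lambda>t. s t x) ` {0..})" for x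
    using low by (intro bdd_belowI2[where m = "- q (- x)"]) auto
  have conc: "concentrate q h x = (INF t\<in>{0..}. s t x)" for x
    by (simp add: concentrate_def s_def)
  have le: "concentrate q h x \<le> s t x" if "0 \<le> t" for t x
    unfolding conc using that by (intro cINF_lower bdd) simp
  show "concentrate q h x \<le> q x"
    using le[of 0 x] by (simp add: s_def)
  show "concentrate q h (- h) \<le> - q h"
    using le[of 1 "- h"] max_sublinear_0[OF q] by (simp add: s_def)
  have antimono: "s t' x \<le> s t x" if "0 \<le> t" "t \<le> t'" for t t' x
  proof -
    have "q ((x + t *\<^sub>R h) + (t' - t) *\<^sub>R h) \<le> q (x + t *\<^sub>R h) + (t' - t) * q h"
      using max_sublinearD(1)[OF q] max_sublinear_scale[OF q] that by (metis diff_ge_0_iff_ge)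
    then show ?thesis
      by (simp add: s_def algebra_simps)
  qed
  have "max_sublinear (\<lambda>x. INF r\<in>s ` {0..}. r x)"
  proof (rule max_sublinear_INF)
    show "bdd_below ((\<lambda>r. r x) ` s ` {0..})" for x
      using bdd by (simp add: image_image)
    show "\<exists>r\<in>s ` {0..}. \<forall>x. r x \<le> p x \<and> r x \<le> q' x"
      if pq: "p \<in> s ` {0..}" "q' \<in> s ` {0..}" for p q'
    proof -
      obtain a b where ab: "0 \<le> a" "0 \<le> b" "p = s a" "q' = s b"
        using pq by auto
      then have "\<forall>x. s (max a b) x \<le> p x \<and> s (max a b) x \<le> q' x"
        using antimono by simp
      moreover have "s (max a b) \<in> s ` {0..}"
        using ab by (intro imageI) simp
      ultimately show ?thesis by blast
    qed
    show "r (sup x y) = max (r x) (r y)" if "r \<in> s ` {0..}" for r x y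
      using that max_sublinearD(3)[OF q] by (auto simp: s_def add_sup_distrib_right max_def)
    show "\<exists>r\<in>s ` {0..}. r (x + y) \<le> p x + q' y"
      if pq: "p \<in> s ` {0..}" "q' \<in> s ` {0..}" for p q' x y
    proof -
      obtain a b where ab: "0 \<le> a" "0 \<le> b" "p = s a" "q' = s b"
        using pq by auto
      have "q ((x + a *\<^sub>R h) + (y + b *\<^sub>R h)) \<le> q (x + a *\<^sub>R h) + q (y + b *\<^sub>R h)"
        by (rule max_sublinearD(1)[OF q])
      then have "s (a + b) (x + y) \<le> p x + q' y"
        by (simp add: s_def ab algebra_simps)
      moreover have "s (a + b) \<in> s ` {0..}"
        using ab by (intro imageI) simp
      ultimately show ?thesis by blast
    qed
    show "\<exists>r\<in>s ` {0..}. r (c *\<^sub>R x) \<le> c * p x" if p: "p \<in> s ` {0..}" and c: "0 < c" for p c x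
    proof -
      obtain a where a: "0 \<le> a" "p = s a"
        using p by auto
      have "q (c *\<^sub>R (x + a *\<^sub>R h)) \<le> c * q (x + a *\<^sub>R h)"
        by (rule max_sublinearD(2)[OF q c])
      then have "s (c * a) (c *\<^sub>R x) \<le> c * p x"
        by (simp add: s_def a algebra_simps)
      moreover have "s (c * a) \<in> s ` {0..}"
        using a c by (intro imageI) simp
      ultimately show ?thesis by blast
    qed
  qed simp
  then show "max_sublinear (concentrate q h)"
    by (simp add: conc[abs_def] image_image)
qed

text \<open>If \<open>q\<close> is minimal, it agrees with all its concentrations, and the one at \<open>h\<close> is at most
  \<open>- q h\<close> at \<open>- h\<close>.  So \<open>q\<close> is odd, and a sublinear functional that is odd is linear.\<close>

lemma minimal_max_sublinear_linear:
  fixes q :: "'e::riesz_space \<Rightarrow> real"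
  assumes q: "max_sublinear q"
    and minimal: "\<And>r. max_sublinear r \<Longrightarrow> (\<And>x. r x \<le> q x) \<Longrightarrow> r = q"
  shows "real_riesz_hom q"
proof -
  have neg: "q (- h) = - q h" for h
  proof (rule antisym)
    have "concentrate q h = q"
      using max_sublinear_concentrate[OF q] concentrate_le[OF q] by (rule minimal)
    then show "q (- h) \<le> - q h"
      using concentrate_uminus[OF q, of h] by simp
    show "- q h \<le> q (- h)"
      using max_sublinear_lower[OF q, of h] by simp
  qed
  have add: "q (x + y) = q x + q y" for x y
  proof (rule antisym)
    show "q (x + y) \<le> q x + q y"
      by (rule max_sublinearD(1)[OF q])
    show "q x + q y \<le> q (x + y)"
      using max_sublinearD(1)[OF q, of "- x" "- y"] neg[of "x + y"] neg[of x] neg[of y]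
      by (simp add: minus_add_distrib)
  qed
  have scale: "q (c *\<^sub>R x) = c * q x" for c x
  proof (cases "0 \<le> c")
    case True
    then show ?thesis by (rule max_sublinear_scale[OF q])
  next
    case False
    then have "q ((- c) *\<^sub>R x) = (- c) * q x"
      by (intro max_sublinear_scale[OF q]) simp
    then show ?thesis
      using neg[of "c *\<^sub>R x"] by simp
  qed
  have "linear q"
    using add scale by (simp add: linear_iff)
  moreover have "q (inf x y) = min (q x) (q y)" for x y
  proof -
    have "inf x y = - sup (- x) (- y)"
      by (simp add: neg_sup_eq_inf)
    then show ?thesis
      using neg[of "sup (- x) (- y)"] max_sublinearD(3)[OF q, of "- x" "- y"] neg[of x] neg[of y]
      by simp
  qed
  ultimately show ?thesis
    using max_sublinearD(3)[OF q] by (simp add: real_riesz_hom_def)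
qed

lemma riesz_hom_below_max_sublinear:
  fixes p :: "'e::riesz_space \<Rightarrow> real"
  assumes p: "max_sublinear p"
  obtains u where "real_riesz_hom u" "\<And>x. u x \<le> p x"
proof -
  define A where "A = {q :: 'e \<Rightarrow> real. max_sublinear q \<and> q \<le> p}"
  define R where "R = relation_of (\<lambda>q r :: 'e \<Rightarrow> real. r \<le> q) A"
  have "partial_order_on A R"
    unfolding R_def by (rule partial_order_on_relation_ofI) auto
  moreover have "\<exists>m\<in>A. \<forall>q\<in>Q. m \<le> q" if Q: "Q \<in> Chains R" for Q
  proof (cases "Q = {}")
    case True
    then show ?thesis using p by (auto simp: A_def)
  next
    case False
    have chain: "q \<in> A \<and> r \<in> A \<and> (r \<le> q \<or> q \<le> r)" if "q \<in> Q" "r \<in> Q" for q r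
      using Q that unfolding Chains_def R_def relation_of_def by blast
    have QA: "max_sublinear q" "q \<le> p" if "q \<in> Q" for q
      using chain[OF that that] by (auto simp: A_def)
    have bdd: "bdd_below ((\<lambda>q. q x) ` Q)" for x
    proof (rule bdd_belowI2)
      fix q assume "q \<in> Q"
      then show "- p (- x) \<le> q x"
        using max_sublinear_lower[of q x] QA[of q] by (meson le_funD neg_le_iff_le order_trans)
    qed
    have dir: "\<exists>r\<in>Q. \<forall>x. r x \<le> q x \<and> r x \<le> q' x" if "q \<in> Q" "q' \<in> Q" for q q'
      using chain[OF that] that by (meson le_funD order_refl)
    have "max_sublinear (\<lambda>x. INF q\<in>Q. q x)"
    proof (rule max_sublinear_INF[OF False bdd dir])
      show "q (sup x y) = max (q x) (q y)" if "q \<in> Q" for q x y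
        by (rule max_sublinearD(3)[OF QA(1)[OF that]])
      show "\<exists>r\<in>Q. r (x + y) \<le> q x + q' y" if qq: "q \<in> Q" "q' \<in> Q" for q q' x y
      proof -
        obtain r where r: "r \<in> Q" "r x \<le> q x" "r y \<le> q' y"
          using dir[OF qq] by blast
        then show ?thesis
          using max_sublinearD(1)[OF QA(1)[OF r(1)], of x y] by (intro bexI[of _ r]) auto
      qed
      show "\<exists>r\<in>Q. r (c *\<^sub>R x) \<le> c * q x" if "q \<in> Q" "0 < c" for q c x
        using max_sublinearD(2)[OF QA(1)] that by blast
    qed
    moreover have low: "(INF q\<in>Q. q x) \<le> q x" if "q \<in> Q" for q x
      by (rule cINF_lower[OF bdd that])
    moreover have "(\<lambda>x. INF q\<in>Q. q x) \<le> p"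
    proof (rule le_funI)
      fix x
      obtain q where "q \<in> Q"
        using False by blast
      then show "(INF q\<in>Q. q x) \<le> p x"
        using low[of q x] le_funD[OF QA(2)[of q], of x] by linarith
    qed
    ultimately show ?thesis
      by (intro bexI[of _ "\<lambda>x. INF q\<in>Q. q x"]) (auto simp: A_def le_fun_def)
  qed
  ultimately obtain u where u: "u \<in> A" "\<And>q. q \<in> A \<Longrightarrow> q \<le> u \<Longrightarrow> q = u"
    using predicate_Zorn[of A "\<lambda>q r. r \<le> q"] unfolding R_def by blast
  have "real_riesz_hom u"
  proof (rule minimal_max_sublinear_linear)
    show "max_sublinear u"
      using u(1) by (simp add: A_def)
    show "r = u" if "max_sublinear r" "\<And>x. r x \<le> u x" for r
      using u(1) that by (intro u(2)) (auto simp: A_def le_fun_def intro: order_trans)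
  qed
  then show ?thesis
    using u(1) by (intro that) (auto simp: A_def le_fun_def)
qed

section \<open>Riesz homomorphisms attaining an M-norm\<close>

lemma riesz_norm_mono:
  assumes "riesz_norm N" "0 \<le> f" "f \<le> g"
  shows "N f \<le> N g"
  using assms by (simp add: riesz_norm_def abs_of_nonneg)

lemma riesz_norm_abs: "riesz_norm N \<Longrightarrow> N \<bar>f\<bar> = N f"
  by (simp add: riesz_norm_def order_antisym)

lemma max_sublinear_norm_positive_part:
  assumes M: "M_norm (norm :: 'e::{riesz_space, real_normed_vector} \<Rightarrow> real)"
  shows "max_sublinear (\<lambda>x :: 'e. norm (sup x 0))"
  unfolding max_sublinear_def
proof (intro conjI allI impI)
  have N: "riesz_norm (norm :: 'e \<Rightarrow> real)"
    using M by (simp add: M_norm_def)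
  fix x y :: 'e
  have "x + y \<le> sup x 0 + sup y 0"
    by (intro add_mono) auto
  moreover have "0 \<le> sup x 0 + sup y 0"
    by (intro add_nonneg_nonneg) auto
  ultimately have "norm (sup (x + y) 0) \<le> norm (sup x 0 + sup y 0)"
    by (intro riesz_norm_mono[OF N]) auto
  then show "norm (sup (x + y) 0) \<le> norm (sup x 0) + norm (sup y 0)"
    using norm_triangle_ineq order_trans by blast
  have "sup (sup x y) 0 = sup (sup x 0) (sup y 0)"
    by (simp add: sup.assoc sup.left_commute)
  then show "norm (sup (sup x y) 0) = max (norm (sup x 0)) (norm (sup y 0))"
    using M by (simp add: M_norm_def)
next
  have N: "riesz_norm (norm :: 'e \<Rightarrow> real)"
    using M by (simp add: M_norm_def)
  fix c :: real and x :: 'e assume c: "0 < c"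
  have "c *\<^sub>R x \<le> c *\<^sub>R sup x 0" "0 \<le> c *\<^sub>R sup x 0"
    using c by (auto intro: scaleR_left_mono scaleR_nonneg_nonneg)
  then have "norm (sup (c *\<^sub>R x) 0) \<le> norm (c *\<^sub>R sup x 0)"
    by (intro riesz_norm_mono[OF N]) auto
  then show "norm (sup (c *\<^sub>R x) 0) \<le> c * norm (sup x 0)"
    using c by simp
qed

text \<open>A functional \<open>u\<close> below the concentration of \<open>p\<close> at \<open>f\<close> has \<open>u (- f) \<le> - p f\<close>, which for linear
  \<open>u\<close> is the lower bound \<open>p f \<le> u f\<close>; the upper bound comes from \<open>u \<le> p\<close>.\<close>

lemma M_norm_attained_by_hom:
  fixes f :: "'e::{riesz_space, real_normed_vector}"
  assumes M: "M_norm (norm :: 'e \<Rightarrow> real)" and f: "0 \<le> f"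
  obtains u where "real_riesz_hom u" "\<And>x. 0 \<le> x \<Longrightarrow> u x \<le> norm x" "u f = norm f"
proof -
  define p where "p x = norm (sup x 0)" for x :: 'e
  have p: "max_sublinear p"
    unfolding p_def by (rule max_sublinear_norm_positive_part[OF M])
  have p_pos: "p x = norm x" if "0 \<le> x" for x
    using that by (simp add: p_def sup_absorb1)
  obtain u where u: "real_riesz_hom u" "\<And>x. u x \<le> concentrate p f x"
    using riesz_hom_below_max_sublinear[OF max_sublinear_concentrate[OF p]] by blast
  have le: "u x \<le> p x" for x
    using u(2) concentrate_le[OF p] order_trans by blast
  have "u (- f) = - u f"
    using u(1) by (simp add: real_riesz_hom_def linear_neg)
  then have "p f \<le> u f"
    using u(2)[of "- f"] concentrate_uminus[OF p, of f] by linarith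
  then have "u f = norm f"
    using le[of f] p_pos[OF f] by simp
  then show ?thesis
    using that u(1) le p_pos by metis
qed

section \<open>The spectrum of the unit ball truncation\<close>

lemma real_riesz_homD:
  assumes "real_riesz_hom u"
  shows "u (f + g) = u f + u g" "u (f - g) = u f - u g" "u (c *\<^sub>R f) = c * u f" "u 0 = 0"
    "u (- f) = - u f" "u (sup f g) = max (u f) (u g)" "u (inf f g) = min (u f) (u g)"
    "u \<bar>f\<bar> = \<bar>u f\<bar>"
proof -
  have lin: "linear u" and s: "\<And>f g. u (sup f g) = max (u f) (u g)"
    using assms by (auto simp: real_riesz_hom_def)
  show "u (f + g) = u f + u g" "u (f - g) = u f - u g" "u (c *\<^sub>R f) = c * u f" "u 0 = 0"
    "u (- f) = - u f"
    using lin by (simp_all add: linear_add linear_diff linear_scale linear_0 linear_neg)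
  show "u (sup f g) = max (u f) (u g)" "u (inf f g) = min (u f) (u g)"
    using assms by (auto simp: real_riesz_hom_def)
  show "u \<bar>f\<bar> = \<bar>u f\<bar>"
    using s[of f "- f"] linear_neg[OF lin, of f] by (simp add: abs_lattice[of f] max_def)
qed

lemma spectrumD:
  assumes "u \<in> spectrum tr"
  shows "real_riesz_hom u" "\<exists>f. u f \<noteq> 0" "0 \<le> f \<Longrightarrow> u (tr f) = min 1 (u f)"
  using assms by (auto simp: spectrum_def)

lemma unit_ball_truncation_le:
  assumes "isLub UNIV {g. 0 \<le> g \<and> g \<le> f \<and> norm g \<le> 1} (tr f)"
    and "0 \<le> g" "g \<le> f" "norm g \<le> 1"
  shows "g \<le> tr f"
  using assms unfolding isLub_UNIV_iff by blast

text \<open>By the Fatou property, the supremum defining \<open>tr f\<close> is a maximum.\<close>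

lemma norm_unit_ball_truncation_le_1:
  fixes tr :: "'e::{riesz_space, real_normed_vector} \<Rightarrow> 'e"
  assumes fatou: "fatou_norm (norm :: 'e \<Rightarrow> real)" and M: "M_norm (norm :: 'e \<Rightarrow> real)"
    and tr: "isLub UNIV {g. 0 \<le> g \<and> g \<le> f \<and> norm g \<le> 1} (tr f)" and f: "0 \<le> f"
  shows "norm (tr f) \<le> 1"
proof -
  define B where "B = {g. 0 \<le> g \<and> g \<le> f \<and> norm g \<le> 1}"
  have zero: "0 \<in> B"
    using f by (simp add: B_def)
  have "sup g h \<in> B" if "g \<in> B" "h \<in> B" for g h
    using M that by (auto simp: B_def M_norm_def intro: le_supI1)
  then have "\<exists>k\<in>B. g \<le> k \<and> h \<le> k" if "g \<in> B" "h \<in> B" for g h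
    using that by (intro bexI[of _ "sup g h"]) auto
  then have "increasing_net B (\<le>) (\<lambda>g. g)"
    using zero unfolding increasing_net_def directed_index_def
    by (auto intro: order_trans)
  moreover have "isLub UNIV ((\<lambda>g. g) ` B) (tr f)"
    using tr by (simp add: B_def)
  moreover have "\<forall>g\<in>B. 0 \<le> g"
    by (simp add: B_def)
  ultimately have "norm (tr f) = (SUP g\<in>B. norm g)"
    using fatou unfolding fatou_norm_def by blast
  also have "\<dots> \<le> 1"
    using zero by (intro cSUP_least) (auto simp: B_def)
  finally show ?thesis .
qed

text \<open>The truncation identity for \<open>g\<close> and the normalized vector \<open>e\<close> determines \<open>u (tr g)\<close> only up to
  truncation at \<open>u e = 1\<close>; the bound \<open>u (tr g) \<le> \<parallel>tr g\<parallel> \<le> 1\<close> supplies the rest.\<close>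

lemma norm_attained_on_spectrum:
  fixes tr :: "'e::{riesz_space, real_normed_vector} \<Rightarrow> 'e"
  assumes fatou: "fatou_norm (norm :: 'e \<Rightarrow> real)" and M: "M_norm (norm :: 'e \<Rightarrow> real)"
    and tr: "\<And>f. 0 \<le> f \<Longrightarrow> isLub UNIV {g. 0 \<le> g \<and> g \<le> f \<and> norm g \<le> 1} (tr f)"
    and "f \<noteq> 0"
  obtains u where "u \<in> spectrum tr" "\<bar>u f\<bar> = norm f"
proof -
  have N: "riesz_norm (norm :: 'e \<Rightarrow> real)"
    using M by (simp add: M_norm_def)
  obtain u where u: "real_riesz_hom u" "\<And>x. 0 \<le> x \<Longrightarrow> u x \<le> norm x" "u \<bar>f\<bar> = norm \<bar>f\<bar>"
    using M_norm_attained_by_hom[OF M, of "\<bar>f\<bar>"] by auto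
  define e where "e = (1 / norm f) *\<^sub>R \<bar>f\<bar>"
  have e: "0 \<le> e" "norm e = 1" "u e = 1"
    using \<open>f \<noteq> 0\<close> u(3) riesz_norm_abs[OF N, of f]
    by (auto simp: e_def real_riesz_homD[OF u(1)] intro: scaleR_nonneg_nonneg)
  have tr_e: "tr e = e"
    using unit_ball_truncation_le[where tr = tr, OF tr[OF e(1)], of e] e tr[OF e(1)]
    unfolding isLub_UNIV_iff by (intro order_antisym) auto
  have "u (tr g) = min 1 (u g)" if g: "0 \<le> g" for g
  proof -
    have trunc: "truncation tr"
      using unit_ball_truncation[OF N tr] .
    then have "0 \<le> tr g" "inf (tr g) e = inf g e"
      using g e(1) tr_e unfolding truncation_def by metis+
    then have "min (u (tr g)) 1 = min (u g) 1"
      using real_riesz_homD(7)[OF u(1)] e(3) by metis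
    moreover have "u (tr g) \<le> 1"
      using u(2)[OF \<open>0 \<le> tr g\<close>] norm_unit_ball_truncation_le_1[where tr = tr, OF fatou M tr[OF g] g] by simp
    ultimately show ?thesis
      by simp
  qed
  moreover have "u \<noteq> (\<lambda>f. 0)"
    using e(3) by auto
  ultimately have "u \<in> spectrum tr"
    using u(1) by (simp add: spectrum_def)
  moreover have "\<bar>u f\<bar> = norm f"
    using u(3) riesz_norm_abs[OF N, of f] real_riesz_homD(8)[OF u(1), of f] by simp
  ultimately show ?thesis
    by (rule that)
qed

text \<open>The one-point compactification of the spectrum: the only further functional that satisfies the
  closed conditions in the definition of the spectrum is zero.\<close>

lemma compact_insert_0_spectrum:
  fixes tr :: "'e::{riesz_space, real_normed_vector} \<Rightarrow> 'e"
  assumes N: "riesz_norm (norm :: 'e \<Rightarrow> real)"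
    and tr: "\<And>f. 0 \<le> f \<Longrightarrow> isLub UNIV {g. 0 \<le> g \<and> g \<le> f \<and> norm g \<le> 1} (tr f)"
  shows "compact (insert (\<lambda>f. 0) (spectrum tr))"
proof -
  define B :: "('e \<Rightarrow> real) set" where "B = PiE UNIV (\<lambda>f. {- norm f..norm f})"
  define C :: "('e \<Rightarrow> real) set" where
    "C = {u. (\<forall>f g. u (f + g) = u f + u g) \<and> (\<forall>c f. u (c *\<^sub>R f) = c * u f) \<and>
      (\<forall>f g. u (sup f g) = max (u f) (u g) \<and> u (inf f g) = min (u f) (u g)) \<and>
      (\<forall>f. 0 \<le> f \<longrightarrow> u (tr f) = min 1 (u f))}"
  have C_iff: "u \<in> C \<longleftrightarrow> real_riesz_hom u \<and> (\<forall>f. 0 \<le> f \<longrightarrow> u (tr f) = min 1 (u f))" for u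
    unfolding C_def real_riesz_hom_def linear_iff by auto
  have coord: "continuous_on UNIV (\<lambda>u :: 'e \<Rightarrow> real. u f)" for f
    by (rule continuous_on_product_coordinates)
  have "closed C"
    unfolding C_def
    by (intro closed_Collect_conj closed_Collect_all closed_Collect_imp closed_Collect_eq
        open_Collect_const continuous_on_add continuous_on_mult continuous_on_max
        continuous_on_min continuous_on_const coord)
  moreover have "compact B"
  proof -
    have "compactin (product_topology (\<lambda>f. euclideanreal) UNIV) B"
      unfolding B_def by (simp add: compactin_PiE)
    then show ?thesis
      by (simp add: euclidean_product_topology)
  qed
  moreover have "C \<subseteq> B"
  proof
    fix u assume "u \<in> C"
    then have "\<bar>u f\<bar> \<le> norm f" for f
      using abs_spectrum_le_norm[OF N tr, of u f] by (simp add: C_iff)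
    then show "u \<in> B"
      unfolding B_def by (simp add: PiE_iff abs_le_iff minus_le_iff)
  qed
  ultimately have "compact C"
    by (metis closed_Int_compact inf.absorb1)
  moreover have "insert (\<lambda>f. 0) (spectrum tr) = C"
    by (auto simp: spectrum_def C_iff real_riesz_hom_def linear_iff)
  ultimately show ?thesis by simp
qed

lemma spectrum_topology_eq: "spectrum_topology tr = top_of_set (spectrum tr)"
  by (simp add: spectrum_topology_def euclidean_product_topology)

text \<open>If the kernel of \<open>v\<close> is contained in that of \<open>u\<close>, then \<open>u = c v\<close>, and evaluating both sides at a
  vector where both truncations are active gives \<open>c = 1\<close>.\<close>

lemma spectrum_separates:
  assumes u: "u \<in> spectrum tr" and v: "v \<in> spectrum tr" and "u \<noteq> v"
  obtains f where "v f = 0" "u f \<noteq> 0"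
proof (rule ccontr)
  assume "\<not> thesis"
  then have ker: "u f = 0" if "v f = 0" for f
    using that \<open>\<And>f. v f = 0 \<Longrightarrow> u f \<noteq> 0 \<Longrightarrow> thesis\<close> by blast
  note uh = real_riesz_homD[OF spectrumD(1)[OF u]] and vh = real_riesz_homD[OF spectrumD(1)[OF v]]
  obtain k where k: "v k \<noteq> 0"
    using spectrumD(2)[OF v] by blast
  define g where "g = (1 / \<bar>v k\<bar>) *\<^sub>R \<bar>k\<bar>"
  have g: "0 \<le> g" "v g = 1"
    using k by (auto simp: g_def vh intro: scaleR_nonneg_nonneg)
  have mult: "u f = v f * u g" for f
  proof -
    have "v (f - v f *\<^sub>R g) = 0"
      by (simp add: vh g)
    then have "u (f - v f *\<^sub>R g) = 0"
      by (rule ker)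
    then show ?thesis
      by (simp add: uh)
  qed
  have "u g \<noteq> 0"
    using spectrumD(2)[OF u] mult by (metis mult_zero_right)
  moreover have "0 \<le> u g"
    using g(1) uh(8)[of g] by simp
  ultimately have c: "0 < u g"
    by simp
  define s where "s = max 1 (1 / u g)"
  have s: "1 \<le> s" "1 \<le> s * u g"
    using c by (auto simp: s_def max_def field_simps)
  then have sg: "0 \<le> s *\<^sub>R g"
    using g(1) by (intro scaleR_nonneg_nonneg) auto
  have "v (tr (s *\<^sub>R g)) = 1" "u (tr (s *\<^sub>R g)) = 1"
    using spectrumD(3)[OF v sg] spectrumD(3)[OF u sg] s by (simp_all add: uh vh g)
  then have "u g = 1"
    using mult[of "tr (s *\<^sub>R g)"] by simp
  then have "u f = v f" for f
    using mult[of f] by simp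
  then show False
    using \<open>u \<noteq> v\<close> by blast
qed

lemma spectrum_interpolates:
  assumes u: "u \<in> insert (\<lambda>f. 0) (spectrum tr)" and v: "v \<in> insert (\<lambda>f. 0) (spectrum tr)"
    and h: "h (\<lambda>f. 0) = (0 :: real)"
  obtains f where "u f = h u" "v f = h v"
proof -
  have one: "\<exists>f. w f = a" if w: "w \<in> spectrum tr" for w a
  proof -
    obtain k where "w k \<noteq> 0"
      using spectrumD(2)[OF w] by blast
    then have "w ((a / w k) *\<^sub>R k) = a"
      by (simp add: real_riesz_homD[OF spectrumD(1)[OF w]])
    then show ?thesis by blast
  qed
  show ?thesis
  proof (cases "u = v \<or> u = (\<lambda>f. 0) \<or> v = (\<lambda>f. 0)")
    case True
    obtain f where "u f = h u \<and> v f = h v"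
    proof (cases "u = (\<lambda>f. 0)")
      case True
      then show ?thesis
        using one[of v "h v"] v h that by auto
    next
      case False
      then show ?thesis
        using \<open>u = v \<or> u = (\<lambda>f. 0) \<or> v = (\<lambda>f. 0)\<close> one[of u "h u"] u h that by auto
    qed
    then show ?thesis
      using that by blast
  next
    case False
    then have uv: "u \<in> spectrum tr" "v \<in> spectrum tr" "u \<noteq> v"
      using u v by auto
    obtain f where f: "v f = 0" "u f \<noteq> 0"
      using spectrum_separates[OF uv] .
    obtain g where g: "u g = 0" "v g \<noteq> 0"
      using spectrum_separates[OF uv(2,1)] uv(3) by metis
    let ?k = "(h u / u f) *\<^sub>R f + (h v / v g) *\<^sub>R g"
    have "u ?k = h u" "v ?k = h v"
      using f g by (simp_all add: real_riesz_homD[OF spectrumD(1)[OF uv(1)]]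
          real_riesz_homD[OF spectrumD(1)[OF uv(2)]])
    then show ?thesis
      by (rule that)
  qed
qed

section \<open>Lattice form of the Stone-Weierstrass theorem\<close>

lemma compact_min_less:
  fixes h :: "'a::topological_space \<Rightarrow> real"
  assumes C: "compact C" "C \<noteq> {}" and h: "continuous_on C h"
    and L: "\<And>k. k \<in> L \<Longrightarrow> continuous_on C k"
    and mn: "\<And>k l. k \<in> L \<Longrightarrow> l \<in> L \<Longrightarrow> (\<lambda>x. min (k x) (l x)) \<in> L"
    and ex: "\<And>v. v \<in> C \<Longrightarrow> \<exists>k\<in>L. k v < h v"
  obtains k where "k \<in> L" "\<And>x. x \<in> C \<Longrightarrow> k x < h x"
proof -
  have "\<exists>k W. k \<in> L \<and> open W \<and> v \<in> W \<and> (\<forall>x\<in>C \<inter> W. k x < h x)" if v: "v \<in> C" for v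
  proof -
    obtain k where k: "k \<in> L" "k v < h v"
      using ex[OF v] by blast
    have "continuous_on C (\<lambda>x. h x - k x)"
      by (intro continuous_on_diff h L k)
    then obtain W where W: "open W" "W \<inter> C = (\<lambda>x. h x - k x) -` {0<..} \<inter> C"
      unfolding continuous_on_open_invariant by (meson open_greaterThan)
    then have "v \<in> W" "\<forall>x\<in>C \<inter> W. k x < h x"
      using k v by auto
    then show ?thesis
      using k W by blast
  qed
  then obtain k W where kW: "\<And>v. v \<in> C \<Longrightarrow> k v \<in> L" "\<And>v. v \<in> C \<Longrightarrow> open (W v)"
      "\<And>v. v \<in> C \<Longrightarrow> v \<in> W v" "\<And>v x. v \<in> C \<Longrightarrow> x \<in> C \<inter> W v \<Longrightarrow> k v x < h x"
    by metis
  obtain D where D: "D \<subseteq> C" "finite D" "C \<subseteq> (\<Union>v\<in>D. W v)"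
    using compactE_image[OF C(1), of C W] kW(2,3) by blast
  have "D \<noteq> {}"
    using D(3) C(2) by auto
  with D(2) have "D \<subseteq> C \<longrightarrow> (\<exists>l\<in>L. \<forall>d\<in>D. \<forall>x. l x \<le> k d x)"
  proof (induction D rule: finite_ne_induct)
    case (singleton d)
    then show ?case using kW(1) by auto
  next
    case (insert d D)
    show ?case
    proof
      assume dD: "insert d D \<subseteq> C"
      then obtain l where "l \<in> L" "\<forall>d\<in>D. \<forall>x. l x \<le> k d x"
        using insert by blast
      then show "\<exists>l\<in>L. \<forall>d\<in>insert d D. \<forall>x. l x \<le> k d x"
        using mn[OF kW(1)[of d], of l] dD
        by (intro bexI[of _ "\<lambda>x. min (k d x) (l x)"]) (auto simp: min_le_iff_disj)
    qed
  qed
  then obtain l where l: "l \<in> L" "\<And>d x. d \<in> D \<Longrightarrow> l x \<le> k d x"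
    using D(1) by blast
  have "l x < h x" if x: "x \<in> C" for x
  proof -
    obtain d where "d \<in> D" "x \<in> W d"
      using D(3) x by blast
    then show ?thesis
      using kW(4)[of d x] l(2)[of d x] D(1) x by force
  qed
  with l(1) show ?thesis
    by (rule that)
qed

lemma Stone_Weierstrass_lattice:
  fixes h :: "'a::topological_space \<Rightarrow> real"
  assumes C: "compact C" "C \<noteq> {}" and h: "continuous_on C h" and \<epsilon>: "0 < \<epsilon>"
    and L: "\<And>k. k \<in> L \<Longrightarrow> continuous_on C k"
    and mn: "\<And>k l. k \<in> L \<Longrightarrow> l \<in> L \<Longrightarrow> (\<lambda>x. min (k x) (l x)) \<in> L"
    and mx: "\<And>k l. k \<in> L \<Longrightarrow> l \<in> L \<Longrightarrow> (\<lambda>x. max (k x) (l x)) \<in> L"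
    and interp: "\<And>u v. u \<in> C \<Longrightarrow> v \<in> C \<Longrightarrow> \<exists>k\<in>L. k u = h u \<and> k v = h v"
  obtains k where "k \<in> L" "\<And>x. x \<in> C \<Longrightarrow> \<bar>h x - k x\<bar> < \<epsilon>"
proof -
  \<comment> \<open>Below \<open>h + \<epsilon>\<close> everywhere and exact at \<open>u\<close>: a finite minimum of interpolants through \<open>u\<close>.\<close>
  have upper: "\<exists>k\<in>L. k u = h u \<and> (\<forall>x\<in>C. k x < h x + \<epsilon>)" if u: "u \<in> C" for u
  proof -
    obtain k where "k \<in> {k \<in> L. k u = h u}" "\<And>x. x \<in> C \<Longrightarrow> k x < h x + \<epsilon>"
    proof (rule compact_min_less[OF C, of "\<lambda>x. h x + \<epsilon>" "{k \<in> L. k u = h u}"])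
      show "continuous_on C (\<lambda>x. h x + \<epsilon>)"
        by (intro continuous_on_add h continuous_on_const)
      show "\<exists>k\<in>{k \<in> L. k u = h u}. k v < h v + \<epsilon>" if "v \<in> C" for v
        using interp[OF u that] \<epsilon> by force
    qed (use L mn in auto)
    then show ?thesis by blast
  qed
  \<comment> \<open>A finite maximum of these is above \<open>h - \<epsilon>\<close> as well; maxima are minima of the negatives.\<close>
  define L' where "L' = {k. (\<lambda>x. - k x) \<in> L \<and> (\<forall>x\<in>C. - k x < h x + \<epsilon>)}"
  obtain k where k: "k \<in> L'" "\<And>x. x \<in> C \<Longrightarrow> k x < - h x + \<epsilon>"
  proof (rule compact_min_less[OF C, of "\<lambda>x. - h x + \<epsilon>" L'])
    show "continuous_on C (\<lambda>x. - h x + \<epsilon>)"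
      by (intro continuous_on_add continuous_on_minus h continuous_on_const)
    show "continuous_on C k" if "k \<in> L'" for k
      using that continuous_on_minus[OF L[of "\<lambda>x. - k x"]] by (simp add: L'_def)
    show "(\<lambda>x. min (k x) (l x)) \<in> L'" if "k \<in> L'" "l \<in> L'" for k l
    proof -
      have "(\<lambda>x. - min (k x) (l x)) = (\<lambda>x. max (- k x) (- l x))"
        by auto
      then show ?thesis
        using that mx[of "\<lambda>x. - k x" "\<lambda>x. - l x"] by (auto simp: L'_def min_def)
    qed
    show "\<exists>k\<in>L'. k v < - h v + \<epsilon>" if v: "v \<in> C" for v
    proof -
      obtain k where "k \<in> L" "k v = h v" "\<forall>x\<in>C. k x < h x + \<epsilon>"
        using upper[OF v] by blast
      then show ?thesis
        using \<epsilon> by (intro bexI[of _ "\<lambda>x. - k x"]) (auto simp: L'_def)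
    qed
  qed blast
  have "\<bar>h x - - k x\<bar> < \<epsilon>" if "x \<in> C" for x
    using k(2)[OF that] k(1) that unfolding L'_def by force
  then show ?thesis
    using k(1) by (intro that[of "\<lambda>x. - k x"]) (auto simp: L'_def)
qed

section \<open>Functions vanishing at infinity\<close>

text \<open>Compact sets have to be closed.  Expressing this through \<open>Hausdorff_space\<close> instead of a type
  class covers the product topology on a function type.\<close>

lemma C0_continuous_on_insert_infinity:
  fixes S :: "'a::topological_space set"
  assumes H: "Hausdorff_space (euclidean :: 'a topology)"
    and h: "h \<in> C0 (top_of_set S)" and z: "z \<notin> S"
  shows "continuous_on (insert z S) h"
  unfolding continuous_on_def
proof
  have closed: "closed K" if "compact K" for K :: "'a set"
    using compactin_imp_closedin[OF H, of K] that by simp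
  have cont: "continuous_on S h" and hz: "h z = 0"
    and cpt: "\<And>\<epsilon>. 0 < \<epsilon> \<Longrightarrow> compact {x \<in> S. \<bar>h x\<bar> \<ge> \<epsilon>}"
    using h z by (auto simp: C0_def compactin_subtopology)
  fix x assume x: "x \<in> insert z S"
  show "(h \<longlongrightarrow> h x) (at x within insert z S)"
  proof (cases "x = z")
    case False
    moreover have "open (- {z})"
      using closed[of "{z}"] by (simp add: open_Compl)
    ultimately have "at x within insert z S = at x within S"
      by (intro at_within_nhd[of x "- {z}"]) auto
    then show ?thesis
      using cont x False unfolding continuous_on_def by auto
  next
    case True
    show ?thesis
    proof (rule tendstoI)
      fix \<epsilon> :: real assume \<epsilon>: "0 < \<epsilon>"
      let ?U = "- {x \<in> S. \<bar>h x\<bar> \<ge> \<epsilon>}"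
      have "open ?U"
        using closed[OF cpt[OF \<epsilon>]] by (simp add: open_Compl)
      moreover have "x \<in> ?U"
        using True z by simp
      moreover have "dist (h y) (h x) < \<epsilon>" if "y \<in> ?U" "y \<noteq> x" "y \<in> insert z S" for y
        using that True hz by (auto simp: dist_real_def)
      ultimately show "\<forall>\<^sub>F y in at x within insert z S. dist (h y) (h x) < \<epsilon>"
        unfolding eventually_at_topological by blast
    qed
  qed
qed

lemma continuous_on_insert_infinity_C0:
  fixes S :: "'a::topological_space set"
  assumes H: "Hausdorff_space (euclidean :: 'a topology)"
    and S: "compact (insert z S)" and z: "z \<notin> S"
    and h: "continuous_on (insert z S) h" and off: "\<And>x. x \<notin> S \<Longrightarrow> h x = 0"
  shows "h \<in> C0 (top_of_set S)"
proof -
  have "compactin (top_of_set S) {x \<in> S. \<bar>h x\<bar> \<ge> \<epsilon>}" if \<epsilon>: "0 < \<epsilon>" for \<epsilon>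
  proof -
    have "closed (insert z S)"
      using compactin_imp_closedin[OF H, of "insert z S"] S by simp
    moreover have "continuous_on (insert z S) (\<lambda>x. \<bar>h x\<bar>)"
      by (intro continuous_intros h)
    ultimately have "closed ((\<lambda>x. \<bar>h x\<bar>) -` {\<epsilon>..} \<inter> insert z S)"
      using continuous_on_closed_vimage closed_atLeast by blast
    then have "compact (insert z S \<inter> ((\<lambda>x. \<bar>h x\<bar>) -` {\<epsilon>..} \<inter> insert z S))"
      by (rule compact_Int_closed[OF S])
    moreover have "insert z S \<inter> ((\<lambda>x. \<bar>h x\<bar>) -` {\<epsilon>..} \<inter> insert z S) = {x \<in> S. \<bar>h x\<bar> \<ge> \<epsilon>}"
      using off[OF z] \<epsilon> by auto
    ultimately show ?thesis
      by (auto simp: compactin_subtopology)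
  qed
  moreover have "continuous_on S h"
    using h continuous_on_subset by blast
  ultimately show ?thesis
    using off by (simp add: C0_def)
qed

lemma uniform_norm_le:
  assumes "0 \<le> b" "\<And>x. x \<in> topspace X \<Longrightarrow> \<bar>h x\<bar> \<le> b"
  shows "uniform_norm X h \<le> b"
  unfolding uniform_norm_def using assms by (intro cSup_least) auto

lemma uniform_norm_eqI:
  assumes "\<And>x. x \<in> topspace X \<Longrightarrow> \<bar>h x\<bar> \<le> b" and "b = 0 \<or> (\<exists>x\<in>topspace X. \<bar>h x\<bar> = b)"
  shows "uniform_norm X h = b"
  unfolding uniform_norm_def using assms by (intro cSup_eq_maximum) auto

section \<open>Representation on the spectrum\<close>

text \<open>Off the spectrum the value is set to \<open>0\<close>, to match the encoding of functions in \<open>C0\<close>.\<close>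

definition evaluation :: "('e::riesz_space \<Rightarrow> 'e) \<Rightarrow> 'e \<Rightarrow> ('e \<Rightarrow> real) \<Rightarrow> real" where
  "evaluation tr f u = (if u \<in> spectrum tr then u f else 0)"

lemma evaluation_homs:
  "evaluation tr (f + g) = (\<lambda>u. evaluation tr f u + evaluation tr g u)"
  "evaluation tr (c *\<^sub>R f) = (\<lambda>u. c * evaluation tr f u)"
  "evaluation tr (sup f g) = (\<lambda>u. max (evaluation tr f u) (evaluation tr g u))"
  "evaluation tr (inf f g) = (\<lambda>u. min (evaluation tr f u) (evaluation tr g u))"
  "evaluation tr 0 = (\<lambda>u. 0)"
  by (auto simp: evaluation_def fun_eq_iff real_riesz_homD[OF spectrumD(1)])

text \<open>The truncation acts on the positive cone only; in \<open>C0\<close>, truncating \<open>h\<close> means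
  truncating \<open>h\<^sup>+\<close> and then subtracting \<open>h\<^sup>-\<close>.\<close>

lemma evaluation_truncation:
  "evaluation tr (tr (sup f 0) - sup (- f) 0) = (\<lambda>u. min 1 (evaluation tr f u))"
proof -
  have "u (tr (sup f 0) - sup (- f) 0) = min 1 (u f)" if u: "u \<in> spectrum tr" for u
    using spectrumD(3)[OF u, of "sup f 0"]
    by (auto simp: real_riesz_homD[OF spectrumD(1)[OF u]])
  then show ?thesis
    by (auto simp: evaluation_def fun_eq_iff)
qed

theorem corollary6p2:
  fixes tr :: "'e::{riesz_space, real_normed_vector} \<Rightarrow> 'e"
  assumes "fatou_norm (norm :: 'e \<Rightarrow> real)"
    and "M_norm (norm :: 'e \<Rightarrow> real)"
    and "\<And>f. 0 \<le> f \<Longrightarrow> isLub UNIV {g. 0 \<le> g \<and> g \<le> f \<and> norm g \<le> 1} (tr f)"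
  shows "\<exists>F \<Phi>. truncated_riesz_subspace_C0 (spectrum_topology tr) F \<and>
                uniformly_dense_C0 (spectrum_topology tr) F \<and>
                isometric_riesz_iso (spectrum_topology tr) F (\<Phi> :: 'e \<Rightarrow> ('e \<Rightarrow> real) \<Rightarrow> real)"
proof -
  let ?X = "spectrum_topology tr"
  let ?\<Phi> = "evaluation tr"
  let ?C = "insert (\<lambda>f. 0) (spectrum tr)"
  have N: "riesz_norm (norm :: 'e \<Rightarrow> real)"
    using assms(2) by (simp add: M_norm_def)
  have top: "topspace ?X = spectrum tr"
    by (simp add: spectrum_topology_eq)
  have C: "compact ?C"
    by (rule compact_insert_0_spectrum[OF N assms(3)])
  have zero: "(\<lambda>f. 0) \<notin> spectrum tr"
    by (simp add: spectrum_def)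
  have on_C: "?\<Phi> f u = u f" if "u \<in> ?C" for f u
    using that by (auto simp: evaluation_def)
  have cont: "continuous_on ?C (?\<Phi> f)" for f
  proof -
    have "continuous_on ?C (\<lambda>u. u f)"
      by (rule continuous_on_subset[OF continuous_on_product_coordinates]) simp
    then show ?thesis
      by (rule continuous_on_eq) (simp add: on_C)
  qed
  have H: "Hausdorff_space (euclidean :: ('e \<Rightarrow> real) topology)"
    by (simp add: Hausdorff_space_product_topology flip: euclidean_product_topology)
  have in_C0: "?\<Phi> f \<in> C0 ?X" for f
    unfolding spectrum_topology_eq
    by (rule continuous_on_insert_infinity_C0[OF H C zero cont]) (simp add: evaluation_def)

  have iso_norm: "uniform_norm ?X (?\<Phi> f) = norm f" for f
  proof (rule uniform_norm_eqI)
    fix u assume "u \<in> topspace ?X"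
    then have u: "u \<in> spectrum tr"
      by (simp add: top)
    have "\<bar>u f\<bar> \<le> norm f"
      using abs_spectrum_le_norm[OF N assms(3) spectrumD(1,3)[OF u]] .
    then show "\<bar>?\<Phi> f u\<bar> \<le> norm f"
      using u by (simp add: evaluation_def)
  next
    show "norm f = 0 \<or> (\<exists>u\<in>topspace ?X. \<bar>?\<Phi> f u\<bar> = norm f)"
    proof (cases "f = 0")
      case False
      then obtain u where "u \<in> spectrum tr" "\<bar>u f\<bar> = norm f"
        using norm_attained_on_spectrum[OF assms] by blast
      then show ?thesis
        by (auto simp: top evaluation_def)
    qed simp
  qed
  have "inj ?\<Phi>"
  proof (rule injI)
    fix f g assume eq: "?\<Phi> f = ?\<Phi> g"
    have "?\<Phi> (f - g) = (\<lambda>u. ?\<Phi> f u + (- 1) * ?\<Phi> g u)"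
      using evaluation_homs(1)[of tr f "(- 1) *\<^sub>R g"] evaluation_homs(2)[of tr "- 1" g] by simp
    then have "?\<Phi> (f - g) = ?\<Phi> 0"
      using eq by (simp add: evaluation_homs(5))
    then have "norm (f - g) = norm (0 :: 'e)"
      using iso_norm[of "f - g"] iso_norm[of 0] by simp
    then show "f = g" by simp
  qed
  then have iso: "isometric_riesz_iso ?X (range ?\<Phi>) ?\<Phi>"
    unfolding isometric_riesz_iso_def
    by (simp add: bij_betw_def evaluation_homs iso_norm)

  have "(\<lambda>u. 0) \<in> range ?\<Phi>"
    using rangeI[of ?\<Phi> 0] by (simp only: evaluation_homs(5))
  then have "riesz_subspace_C0 ?X (range ?\<Phi>)"
    unfolding riesz_subspace_C0_def using in_C0
    by (auto simp flip: evaluation_homs(1-4))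
  then have sub: "truncated_riesz_subspace_C0 ?X (range ?\<Phi>)"
    unfolding truncated_riesz_subspace_C0_def by (auto simp flip: evaluation_truncation)

  have "\<exists>k\<in>range ?\<Phi>. uniform_norm ?X (\<lambda>u. h u - k u) < \<epsilon>" if h: "h \<in> C0 ?X" and \<epsilon>: "0 < \<epsilon>" for h \<epsilon>
  proof -
    have h0: "h (\<lambda>f. 0) = 0"
      using h zero by (simp add: C0_def top)
    obtain k where k: "k \<in> range ?\<Phi>" "\<And>u. u \<in> ?C \<Longrightarrow> \<bar>h u - k u\<bar> < \<epsilon> / 2"
    proof (rule Stone_Weierstrass_lattice[OF C _ _ _ _ _ _, of h "\<epsilon> / 2" "range ?\<Phi>"])
      show "continuous_on ?C h"
        using h zero unfolding spectrum_topology_eq by (rule C0_continuous_on_insert_infinity[OF H])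
      show "\<exists>k\<in>range ?\<Phi>. k u = h u \<and> k v = h v" if uv: "u \<in> ?C" "v \<in> ?C" for u v
      proof -
        obtain f where "u f = h u" "v f = h v"
          using spectrum_interpolates[where h = h, OF uv h0] .
        then show ?thesis
          using uv by (intro bexI[of _ "?\<Phi> f"]) (simp_all add: on_C)
      qed
    qed (use \<epsilon> cont in \<open>auto simp flip: evaluation_homs\<close>)
    have "uniform_norm ?X (\<lambda>u. h u - k u) \<le> \<epsilon> / 2"
      using k(2) \<epsilon> by (intro uniform_norm_le) (auto simp: top intro: less_imp_le)
    then show ?thesis
      using k(1) \<epsilon> by (intro bexI[of _ k]) auto
  qed
  then have "uniformly_dense_C0 ?X (range ?\<Phi>)"
    by (simp add: uniformly_dense_C0_def)
  with sub iso show ?thesis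
    by blast
qed

end
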